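(* There exists $\varepsilon > 0$ such that $$\inf\left\{\frac{\lambda_{n-1}(G) + \lambda_n(G)}{n} : G \text{ a graph with } |V(G)| = n \ge 3\right\} > -\frac{\sqrt{2}}{2} + \varepsilon.$$
   Context: Graphs are finite, simple and undirected. For a graph $G$ on $n \ge 3$ vertices, $\lambda_1(G) \ge \lambda_2(G) \ge \dots \ge \lambda_n(G)$ denote the eigenvalues (with multiplicity) of its adjacency matrix. The infimum is over all orders $n \ge 3$ and all graphs of order $n$. *)

theory Defs
  imports
    Complex_Main
    "Graph_Theory.Pair_Digraph"
    "Jordan_Normal_Form.Char_Poly"
begin

text \<open>
  A finite simple undirected graph is a \<^locale>\<open>pair_graph\<close>: a finite vertex set together with a
  symmetric irreflexive set of ordered pairs of vertices, each edge being present in both directions.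
  Rows and columns of the adjacency matrix are indexed by the vertices in increasing order; a
  different enumeration would give a permutation-similar matrix.
\<close>

definition adjacency_matrix :: "'a::linorder pair_pre_digraph \<Rightarrow> real mat" where
  "adjacency_matrix G =
    (let vs = sorted_list_of_set (pverts G); n = card (pverts G)
     in mat n n (\<lambda>(i, j). if (vs ! i, vs ! j) \<in> parcs G then 1 else 0))"

text \<open>
  Only real roots of the characteristic polynomial are listed. For a real symmetric matrix these
  are all the roots, and their algebraic and geometric multiplicities agree.
\<close>

definition eigenvalues_desc :: "real mat \<Rightarrow> real list" where
  "eigenvalues_desc A = rev (sorted_list_of_multiset (proots (char_poly A)))"

text \<open>The index \<open>k\<close> is 1-based: \<open>graph_eigenvalue G 1\<close> is the largest eigenvalue.\<close>

definition graph_eigenvalue :: "'a::linorder pair_pre_digraph \<Rightarrow> nat \<Rightarrow> real" where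
  "graph_eigenvalue G k = eigenvalues_desc (adjacency_matrix G) ! (k - 1)"

end

theory Submission
  imports Defs "HOL-Analysis.Convex" "Jordan_Normal_Form.Schur_Decomposition"
begin

text \<open>
  Let \<open>u\<close> and \<open>v\<close> be orthonormal vectors at which the quadratic form of the adjacency matrix \<open>A\<close> takes
  the two smallest eigenvalues as values, and put \<open>p i = (u i, v i)\<close>, a point of the plane for each
  vertex. The sum of the two eigenvalues is the sum of \<open>A i j * K i j\<close> over all \<open>i\<close> and \<open>j\<close>, where
  \<open>K i j\<close> is the inner product of \<open>p i\<close> and \<open>p j\<close>. Since the entries of \<open>A\<close> lie between \<open>0\<close> and \<open>1\<close>,
  this is at least the sum of the negative entries of \<open>K\<close>, and since the entries of \<open>K\<close> have a
  nonnegative sum (it is the squared norm of the sum of all \<open>p i\<close>), it is at least minus half the sum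
  of all \<open>\<bar>K i j\<bar>\<close>.

  The matrix \<open>K\<close> is an orthogonal projection of rank 2, so its squared entries add up to \<open>2\<close>, and the
  Cauchy--Schwarz inequality bounds the sum of \<open>\<bar>K i j\<bar>\<close> by \<open>sqrt 2 * n\<close>. That is the constant
  \<open>- (sqrt 2 / 2)\<close>. The gain is the purely geometric lemma \<open>sum_abs_inner_tight_frame_le\<close>: a
  sum close to that bound would force most of the \<open>p i\<close> to have nearly the same length and to be
  pairwise at about 45 degrees up to sign, and the plane has no room for that.
  Doubling the angles turns this obstruction into a quantitative one and improves the bound
  by a factor \<open>31/32\<close>, uniformly in \<open>n\<close>.

  On the spectral side it is only needed that the characteristic polynomial of a real symmetric
  matrix splits over the reals, and that a Schur decomposition yields \<open>u\<close> and \<open>v\<close>.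
\<close>

section \<open>Absolute inner products in a tight frame of the plane\<close>

text \<open>
  The Taylor polynomial \<open>1 + z / 2\<close> alone gives the bound with constant \<open>\<surd>2 / 2\<close>. The
  whole improvement comes from the quadratic term, which is available because the square root
  is strictly concave.
\<close>

lemma sqrt_one_plus_le:
  fixes z :: real
  assumes "\<bar>z\<bar> \<le> 1"
  shows "sqrt (1 + z) \<le> 1 + z / 2 - z\<^sup>2 / 16"
proof (rule real_le_lsqrt)
  have sq: "z\<^sup>2 \<le> 1"
    using assms by (simp add: abs_square_le_1)
  show "0 \<le> 1 + z / 2 - z\<^sup>2 / 16"
    using assms sq by (auto simp: abs_le_iff)
  have "(1 + z / 2 - z\<^sup>2 / 16)\<^sup>2 - (1 + z) = z\<^sup>2 * (1/8 - z/16 + z\<^sup>2/256)"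
    by (simp add: power2_eq_square field_simps)
  moreover have "z\<^sup>2 * (1/8 - z/16 + z\<^sup>2/256) \<ge> 0"
    using assms by (intro mult_nonneg_nonneg add_nonneg_nonneg) (auto simp: abs_le_iff)
  ultimately show "1 + z \<le> (1 + z / 2 - z\<^sup>2 / 16)\<^sup>2"
    by linarith
qed

text \<open>
  Two plane vectors at angle \<open>\<phi>\<close> have \<open>\<bar>cos \<phi>\<bar> = sqrt ((1 + cos (2 * \<phi>)) / 2)\<close>. Here \<open>z\<close> is
  \<open>cos (2 * \<phi>)\<close>, written as the inner product of the two unit vectors with doubled arguments.
  Passing to doubled angles removes the absolute value and leaves a polynomial in \<open>z\<close> that can be
  summed over all pairs. For the zero vector the doubled unit vector is \<open>0 / 0 = 0\<close>, which is
  harmless because both sides of the inequality vanish.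
\<close>

lemma abs_inner_le_double_angle:
  fixes x y x' y' :: real
  defines "r \<equiv> sqrt (x\<^sup>2 + y\<^sup>2)" and "r' \<equiv> sqrt (x'\<^sup>2 + y'\<^sup>2)"
  defines "z \<equiv> (x\<^sup>2 - y\<^sup>2) / (x\<^sup>2 + y\<^sup>2) * ((x'\<^sup>2 - y'\<^sup>2) / (x'\<^sup>2 + y'\<^sup>2))
              + 2 * x * y / (x\<^sup>2 + y\<^sup>2) * (2 * x' * y' / (x'\<^sup>2 + y'\<^sup>2))"
  shows "\<bar>x * x' + y * y'\<bar> \<le> r * r' / sqrt 2 * (1 + z / 2 - z\<^sup>2 / 16)"
proof (cases "x\<^sup>2 + y\<^sup>2 = 0 \<or> x'\<^sup>2 + y'\<^sup>2 = 0")
  case True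
  then show ?thesis
    by (auto simp: r_def r'_def)
next
  case False
  define s s' where "s = x\<^sup>2 + y\<^sup>2" and "s' = x'\<^sup>2 + y'\<^sup>2"
  have pos: "s > 0" "s' > 0"
    using False unfolding s_def s'_def by (auto simp: sum_power2_gt_zero_iff)
  have zs: "s * s' * z = (x\<^sup>2 - y\<^sup>2) * (x'\<^sup>2 - y'\<^sup>2) + 4 * x * y * x' * y'"
    using pos unfolding z_def s_def[symmetric] s'_def[symmetric] by (simp add: field_simps)
  have up: "s * s' * (1 + z) = 2 * (x * x' + y * y')\<^sup>2"
    unfolding distrib_left zs unfolding s_def s'_def by (simp add: power2_eq_square algebra_simps)
  have dn: "s * s' * (1 - z) = 2 * (x * y' - y * x')\<^sup>2"
    unfolding right_diff_distrib zs unfolding s_def s'_def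
    by (simp add: power2_eq_square algebra_simps)
  have "0 \<le> s * s' * (1 + z)" "0 \<le> s * s' * (1 - z)"
    unfolding up dn by auto
  then have z1: "\<bar>z\<bar> \<le> 1"
    using mult_pos_pos[OF pos] by (auto simp: zero_le_mult_iff)
  have "\<bar>x * x' + y * y'\<bar> = sqrt ((x * x' + y * y')\<^sup>2)"
    by simp
  also have "(x * x' + y * y')\<^sup>2 = s * s' / 2 * (1 + z)"
    using up by simp
  also have "sqrt \<dots> = r * r' / sqrt 2 * sqrt (1 + z)"
    by (simp add: real_sqrt_mult real_sqrt_divide r_def r'_def s_def s'_def)
  also have "\<dots> \<le> r * r' / sqrt 2 * (1 + z / 2 - z\<^sup>2 / 16)"
    by (intro mult_left_mono sqrt_one_plus_le z1) (auto simp: r_def r'_def)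
  finally show ?thesis .
qed

text \<open>
  The vectors \<open>p i = (x i, y i)\<close> form a tight frame of the plane: the hypotheses say that
  the sum of \<open>p i\<close> times its transpose is the identity matrix. The Cauchy--Schwarz inequality alone
  bounds the sum by \<open>sqrt 2 * card I\<close>. To come close to this value, almost all lengths would have
  to be close to \<open>sqrt (2 / card I)\<close> and almost all inner products close to \<open>sqrt 2 / card I\<close> in
  absolute value. Almost any two of the vectors would then be at about 45 degrees up to sign, and
  their doubled directions nearly orthogonal; but the plane does not contain even three pairwise
  orthogonal directions. The factor \<open>31/32\<close> quantifies this.

  Let \<open>r i\<close> be the lengths, \<open>S\<close> their sum, \<open>(c i, d i)\<close> the doubled directions and \<open>z i j\<close> the inner
  products of the latter. The estimate for one pair leaves two double sums to control.
  The sum of \<open>r i * r j * z i j\<close> is the squared norm of the sum of \<open>r i * (c i, d i)\<close>. The frame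
  condition makes the sum of \<open>(r i)\<^sup>2 * (c i, d i)\<close> vanish, so the former is small as soon as the
  lengths are nearly equal, that is, as soon as \<open>S\<close> is close to its maximum \<open>sqrt (2 * card I)\<close>.
  The sum of \<open>r i * r j * (z i j)\<^sup>2\<close> is the squared Frobenius norm of a positive semidefinite
  2-by-2 matrix of trace \<open>S\<close>, hence at least \<open>S\<^sup>2 / 2\<close>; this is the plane's obstruction to pairwise
  orthogonality. If \<open>S\<close> is far from maximal, the trivial bound \<open>S\<^sup>2\<close> suffices.
\<close>

lemma sum_abs_inner_tight_frame_le:
  fixes x y :: "'i \<Rightarrow> real"
  assumes fin: "finite I"
    and x: "(\<Sum>i\<in>I. (x i)\<^sup>2) = 1" and y: "(\<Sum>i\<in>I. (y i)\<^sup>2) = 1"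
    and xy: "(\<Sum>i\<in>I. x i * y i) = 0"
  shows "(\<Sum>i\<in>I. \<Sum>j\<in>I. \<bar>x i * x j + y i * y j\<bar>) \<le> 31/32 * sqrt 2 * card I"
proof -
  define n where "n = real (card I)"
  define s where "s i = (x i)\<^sup>2 + (y i)\<^sup>2" for i
  define r where "r i = sqrt (s i)" for i
  define c where "c i = ((x i)\<^sup>2 - (y i)\<^sup>2) / s i" for i
  define d where "d i = 2 * x i * y i / s i" for i
  define z where "z i j = c i * c j + d i * d j" for i j
  define S where "S = (\<Sum>i\<in>I. r i)"
  define t where "t = sqrt (2 * n)"
  have r0: "r i \<ge> 0" for i by (simp add: r_def s_def)
  have r2: "(r i)\<^sup>2 = s i" for i by (simp add: r_def s_def)
  have "I \<noteq> {}" using x by auto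
  then have n0: "n > 0" using fin by (simp add: n_def card_gt_0_iff)
  have t0: "t > 0" and t2: "t\<^sup>2 = 2 * n" using n0 by (auto simp: t_def)
  have s0: "x i = 0 \<and> y i = 0" if "s i = 0" for i
    using that by (simp add: s_def sum_power2_eq_zero_iff)
  have rc: "(r i)\<^sup>2 * c i = (x i)\<^sup>2 - (y i)\<^sup>2" for i
    using s0[of i] by (cases "s i = 0") (auto simp: r2 c_def)
  have rd: "(r i)\<^sup>2 * d i = 2 * x i * y i" for i
    using s0[of i] by (cases "s i = 0") (auto simp: r2 d_def)
  have unit: "r i * ((c i)\<^sup>2 + (d i)\<^sup>2) = r i" for i
  proof (cases "s i = 0")
    case False
    have "((x i)\<^sup>2 - (y i)\<^sup>2)\<^sup>2 + (2 * x i * y i)\<^sup>2 = (s i)\<^sup>2"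
      unfolding s_def by (simp add: power2_eq_square algebra_simps)
    with False have "(c i)\<^sup>2 + (d i)\<^sup>2 = 1"
      by (simp add: c_def d_def power_divide add_divide_distrib[symmetric])
    then show ?thesis by simp
  qed (simp add: r_def)
  have sum_r2: "(\<Sum>i\<in>I. (r i)\<^sup>2) = 2"
    by (simp add: r2 s_def sum.distrib x y)
  have sum_rc: "(\<Sum>i\<in>I. (r i)\<^sup>2 * c i) = 0"
    by (simp add: rc sum_subtractf x y)
  have sum_rd: "(\<Sum>i\<in>I. (r i)\<^sup>2 * d i) = 0"
    unfolding rd using xy by (simp add: mult.assoc sum_distrib_left[symmetric])
  have S0: "S \<ge> 0" by (simp add: S_def r0 sum_nonneg)
  have "S\<^sup>2 \<le> (\<Sum>i\<in>I. (r i)\<^sup>2) * (\<Sum>i\<in>I. 1\<^sup>2)"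
    using Cauchy_Schwarz_ineq_sum[of r "\<lambda>_. 1" I] by (simp add: S_def)
  then have "S\<^sup>2 \<le> t\<^sup>2" by (simp add: sum_r2 t2 n_def)
  then have St: "S \<le> t" using t0 by (rule power2_le_imp_le[OF _ less_imp_le])

  define F where "F g = (\<Sum>i\<in>I. r i * g i)" for g
  have prod: "(\<Sum>i\<in>I. \<Sum>j\<in>I. (r i * g i) * (r j * g j)) = (F g)\<^sup>2" for g
    by (simp add: F_def power2_eq_square sum_product)

  \<comment> \<open>If \<open>S = t\<close>, then all lengths are \<open>2 / t\<close>; in general, \<open>h i\<close> is the relative deviation
    from this length.\<close>
  define h where "h i = 1 - r i * t / 2" for i
  have sum_h: "(\<Sum>i\<in>I. (h i)\<^sup>2) = 2 * n - t * S"
  proof -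
    have "(\<Sum>i\<in>I. (h i)\<^sup>2) = (\<Sum>i\<in>I. 1 - t * r i + t\<^sup>2 / 4 * (r i)\<^sup>2)"
      by (rule sum.cong) (auto simp: h_def power2_eq_square algebra_simps)
    also have "\<dots> = n - t * S + t\<^sup>2 / 4 * 2"
      unfolding sum.distrib sum_subtractf sum_distrib_left[symmetric] sum_r2 S_def
      by (simp add: n_def)
    finally show ?thesis by (simp add: t2)
  qed
  \<comment> \<open>Since \<open>g\<close> averages to zero against \<open>(r i)\<^sup>2\<close>, only the deviations \<open>h i\<close> contribute to \<open>F g\<close>.\<close>
  have Fh: "(F g)\<^sup>2 \<le> (\<Sum>i\<in>I. (r i * g i)\<^sup>2) * (\<Sum>i\<in>I. (h i)\<^sup>2)"
    if "(\<Sum>i\<in>I. (r i)\<^sup>2 * g i) = 0" for g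
  proof -
    have "(\<Sum>i\<in>I. (r i * g i) * h i) = (\<Sum>i\<in>I. r i * g i - t / 2 * ((r i)\<^sup>2 * g i))"
      by (rule sum.cong) (auto simp: h_def power2_eq_square algebra_simps)
    also have "\<dots> = F g"
      unfolding sum_subtractf sum_distrib_left[symmetric] that by (simp add: F_def)
    finally show ?thesis
      using Cauchy_Schwarz_ineq_sum[of "\<lambda>i. r i * g i" h I] by simp
  qed
  have A1: "(\<Sum>i\<in>I. \<Sum>j\<in>I. r i * r j * z i j) \<le> 4 * n - 2 * t * S"
  proof -
    have "(\<Sum>i\<in>I. \<Sum>j\<in>I. r i * r j * z i j) = (F c)\<^sup>2 + (F d)\<^sup>2"
      unfolding prod[symmetric] sum.distrib[symmetric]
      by (intro sum.cong refl) (simp add: z_def algebra_simps)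
    also have "\<dots> \<le> ((\<Sum>i\<in>I. (r i * c i)\<^sup>2) + (\<Sum>i\<in>I. (r i * d i)\<^sup>2)) * (\<Sum>i\<in>I. (h i)\<^sup>2)"
      using Fh[OF sum_rc] Fh[OF sum_rd] by (simp add: distrib_right)
    also have "(\<Sum>i\<in>I. (r i * c i)\<^sup>2) + (\<Sum>i\<in>I. (r i * d i)\<^sup>2)
        = (\<Sum>i\<in>I. r i * (r i * ((c i)\<^sup>2 + (d i)\<^sup>2)))"
      unfolding sum.distrib[symmetric]
      by (intro sum.cong refl) (simp add: power2_eq_square algebra_simps)
    also have "\<dots> = 2"
      unfolding unit using sum_r2 by (simp add: power2_eq_square)
    finally show ?thesis by (simp add: sum_h)
  qed
  have A2: "(\<Sum>i\<in>I. \<Sum>j\<in>I. r i * r j * (z i j)\<^sup>2) \<ge> S\<^sup>2 / 2"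
  proof -
    \<comment> \<open>The entries of the 2-by-2 matrix with trace \<open>S\<close>.\<close>
    define a b e where "a = F (\<lambda>i. (c i)\<^sup>2)" and "b = F (\<lambda>i. (d i)\<^sup>2)" and "e = F (\<lambda>i. c i * d i)"
    have "(\<Sum>i\<in>I. \<Sum>j\<in>I. r i * r j * (z i j)\<^sup>2) = a\<^sup>2 + b\<^sup>2 + 2 * e\<^sup>2"
      unfolding a_def b_def e_def prod[symmetric] sum_distrib_left sum.distrib[symmetric]
      by (intro sum.cong refl) (simp add: z_def power2_eq_square algebra_simps)
    moreover have "a + b = S"
      unfolding a_def b_def F_def S_def sum.distrib[symmetric]
      by (intro sum.cong refl) (use unit in \<open>simp add: distrib_left\<close>)
    moreover have "a\<^sup>2 + b\<^sup>2 + 2 * e\<^sup>2 \<ge> (a + b)\<^sup>2 / 2"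
    proof -
      have "a\<^sup>2 + b\<^sup>2 + 2 * e\<^sup>2 = (a + b)\<^sup>2 / 2 + ((a - b)\<^sup>2 / 2 + 2 * e\<^sup>2)"
        by (simp add: power2_eq_square field_simps)
      moreover have "0 \<le> (a - b)\<^sup>2 / 2 + 2 * e\<^sup>2"
        by simp
      ultimately show ?thesis
        by (metis le_add_same_cancel1)
    qed
    ultimately show ?thesis by simp
  qed
  have pw: "\<bar>x i * x j + y i * y j\<bar> \<le> r i * r j / sqrt 2 * (1 + z i j / 2 - (z i j)\<^sup>2 / 16)" for i j
    using abs_inner_le_double_angle[of "x i" "x j" "y i" "y j"]
    unfolding z_def c_def d_def r_def s_def .
  have SS: "(\<Sum>i\<in>I. \<Sum>j\<in>I. r i * r j) = S\<^sup>2"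
    by (simp add: S_def power2_eq_square sum_product)
  define T where "T = (\<Sum>i\<in>I. \<Sum>j\<in>I. \<bar>x i * x j + y i * y j\<bar>)"
  have "T \<le> (\<Sum>i\<in>I. \<Sum>j\<in>I. r i * r j / sqrt 2 * (1 + z i j / 2 - (z i j)\<^sup>2 / 16))"
    unfolding T_def by (intro sum_mono pw)
  also have "\<dots> = (\<Sum>i\<in>I. \<Sum>j\<in>I. (1 / sqrt 2) * (r i * r j + 1/2 * (r i * r j * z i j)
      - 1/16 * (r i * r j * (z i j)\<^sup>2)))"
    by (intro sum.cong refl) (simp add: field_simps)
  also have "\<dots> = 1 / sqrt 2 * (S\<^sup>2 + 1/2 * (\<Sum>i\<in>I. \<Sum>j\<in>I. r i * r j * z i j)
      - 1/16 * (\<Sum>i\<in>I. \<Sum>j\<in>I. r i * r j * (z i j)\<^sup>2))"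
    unfolding SS[symmetric] sum_distrib_left[symmetric] sum.distrib sum_subtractf ..
  also have "\<dots> \<le> 1 / sqrt 2 * (31/32 * S\<^sup>2 + 2 * n - t * S)"
    using A1 A2 by (intro mult_left_mono) auto
  finally have T1: "T \<le> 1 / sqrt 2 * (31/32 * S\<^sup>2 + 2 * n - t * S)" .
  have T2: "T \<le> S\<^sup>2"
    unfolding T_def SS[symmetric]
  proof (intro sum_mono)
    fix i j
    have "(x i * x j + y i * y j)\<^sup>2 \<le> s i * s j"
      using zero_le_power2[of "x i * y j - y i * x j"]
      unfolding s_def by (simp add: power2_eq_square algebra_simps)
    then have "sqrt ((x i * x j + y i * y j)\<^sup>2) \<le> sqrt (s i * s j)"
      by (rule real_sqrt_le_mono)
    then show "\<bar>x i * x j + y i * y j\<bar> \<le> r i * r j"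
      by (simp add: r_def real_sqrt_mult)
  qed
  have "T \<le> 31/32 * sqrt 2 * n"
  \<comment> \<open>The bound \<open>T1\<close> is a convex quadratic in \<open>S\<close> that takes the value claimed at \<open>S = t\<close> and at
    \<open>S = t / 31\<close>.\<close>
  proof (cases "t \<le> 31 * S")
    case True
    then have "(31 * S - t) * (t - S) \<ge> 0" using St by simp
    then have "31/32 * S\<^sup>2 + 2 * n - t * S \<le> 31/32 * (2 * n)"
      unfolding t2[symmetric] by (simp add: power2_eq_square algebra_simps)
    then have "1 / sqrt 2 * (31/32 * S\<^sup>2 + 2 * n - t * S) \<le> 1 / sqrt 2 * (31/32 * (2 * n))"
      by (intro mult_left_mono) auto
    also have "\<dots> = 31/32 * sqrt 2 * n"
      by (simp add: field_simps)
    finally show ?thesis using T1 by linarith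
  next
    case False
    then have "(31 * S)\<^sup>2 \<le> t\<^sup>2" using S0 by (intro power_mono) auto
    then have "S\<^sup>2 \<le> 31/32 * n" using n0 by (simp add: t2 power_mult_distrib)
    also have "\<dots> \<le> 31/32 * n * sqrt 2" using n0 by simp
    finally show ?thesis using T2 by (simp add: mult_ac)
  qed
  then show ?thesis by (simp add: T_def n_def)
qed

section \<open>Quadratic forms of matrices with entries in the unit interval\<close>

lemma sum_quadratic_forms_orthonormal_ge:
  fixes a :: "'i \<Rightarrow> 'i \<Rightarrow> real" and u v :: "'i \<Rightarrow> real"
  assumes fin: "finite I"
    and a: "\<And>i j. i \<in> I \<Longrightarrow> j \<in> I \<Longrightarrow> 0 \<le> a i j \<and> a i j \<le> 1"
    and uv: "(\<Sum>i\<in>I. (u i)\<^sup>2) = 1" "(\<Sum>i\<in>I. (v i)\<^sup>2) = 1" "(\<Sum>i\<in>I. u i * v i) = 0"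
  shows "(\<Sum>i\<in>I. \<Sum>j\<in>I. a i j * (u i * u j)) + (\<Sum>i\<in>I. \<Sum>j\<in>I. a i j * (v i * v j))
    \<ge> - (31/64) * sqrt 2 * card I"
proof -
  define K where "K i j = u i * u j + v i * v j" for i j
  have K0: "(\<Sum>i\<in>I. \<Sum>j\<in>I. K i j) = (\<Sum>i\<in>I. u i)\<^sup>2 + (\<Sum>i\<in>I. v i)\<^sup>2"
    by (simp add: K_def sum.distrib power2_eq_square sum_product)
  have pw: "(K i j - \<bar>K i j\<bar>) / 2 \<le> a i j * K i j" if "i \<in> I" "j \<in> I" for i j
  proof (cases "K i j \<ge> 0")
    case False
    then have "a i j * K i j \<ge> 1 * K i j"
      using a[OF that] by (intro mult_right_mono_neg) auto
    with False show ?thesis by simp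
  qed (use a[OF that] in auto)
  have "- (31/64) * sqrt 2 * card I \<le> - (\<Sum>i\<in>I. \<Sum>j\<in>I. \<bar>K i j\<bar>) / 2"
    using sum_abs_inner_tight_frame_le[OF fin uv] by (simp add: K_def)
  also have "\<dots> \<le> ((\<Sum>i\<in>I. \<Sum>j\<in>I. K i j) - (\<Sum>i\<in>I. \<Sum>j\<in>I. \<bar>K i j\<bar>)) / 2"
    unfolding K0 by simp
  also have "\<dots> = (\<Sum>i\<in>I. \<Sum>j\<in>I. (K i j - \<bar>K i j\<bar>) / 2)"
    by (simp add: sum_subtractf sum_divide_distrib[symmetric])
  also have "\<dots> \<le> (\<Sum>i\<in>I. \<Sum>j\<in>I. a i j * K i j)"
    by (intro sum_mono pw)
  finally show ?thesis
    by (simp add: K_def distrib_left sum.distrib)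
qed

section \<open>Spectra of real symmetric matrices\<close>

text \<open>
  For an eigenvector \<open>v\<close>, the Hermitian form \<open>Q\<close> of \<open>A\<close> at \<open>v\<close> equals \<open>k\<close> times the squared norm
  of \<open>v\<close>, and it is its own conjugate because \<open>A\<close> is real and symmetric.
\<close>

lemma eigenvalue_of_real_symmetric_real:
  fixes A :: "real mat"
  assumes A: "A \<in> carrier_mat n n" and sym: "transpose_mat A = A"
    and ev: "eigenvalue (map_mat complex_of_real A) k"
  shows "k \<in> \<real>"
proof -
  from ev obtain v where v: "v \<in> carrier_vec n" "v \<noteq> 0\<^sub>v n"
    and Av: "map_mat complex_of_real A *\<^sub>v v = k \<cdot>\<^sub>v v"
    using A by (auto simp: eigenvalue_def eigenvector_def)
  have symA: "A $$ (j, i) = A $$ (i, j)" if "i < n" "j < n" for i j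
    using sym A that by (metis carrier_matD index_transpose_mat(1))
  have row: "(\<Sum>j<n. of_real (A $$ (i, j)) * v $ j) = k * v $ i" if "i < n" for i
  proof -
    have "(map_mat complex_of_real A *\<^sub>v v) $ i = (\<Sum>j<n. of_real (A $$ (i, j)) * v $ j)"
      using that A v by (auto simp: scalar_prod_def atLeast0LessThan intro!: sum.cong)
    then show ?thesis using Av that v by simp
  qed
  define N where "N = (\<Sum>i<n. (cmod (v $ i))\<^sup>2)"
  define Q where "Q = (\<Sum>i<n. \<Sum>j<n. cnj (v $ i) * of_real (A $$ (i, j)) * v $ j)"
  have "Q = (\<Sum>i<n. cnj (v $ i) * (k * v $ i))"
    unfolding Q_def by (intro sum.cong refl) (simp add: row[symmetric] sum_distrib_left mult.assoc)
  also have "\<dots> = k * of_real N"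
    unfolding N_def of_real_sum sum_distrib_left
    by (intro sum.cong refl) (metis complex_norm_square mult.commute mult.left_commute)
  finally have Q: "Q = k * of_real N" .
  have "cnj Q = (\<Sum>i<n. \<Sum>j<n. cnj (v $ j) * of_real (A $$ (j, i)) * v $ i)"
    unfolding Q_def by (auto simp: symA mult_ac intro!: sum.cong)
  also have "\<dots> = Q"
    unfolding Q_def by (rule sum.swap)
  finally have "cnj k * of_real N = k * of_real N"
    using Q by simp
  moreover have "N \<noteq> 0"
  proof
    assume "N = 0"
    then have "\<forall>i<n. v $ i = 0"
      unfolding N_def by (subst (asm) sum_nonneg_eq_0_iff) auto
    then have "v = 0\<^sub>v n" using v(1) by (intro eq_vecI) auto
    with v(2) show False by simp
  qed
  ultimately have "cnj k = k" by simp
  then show ?thesis by (simp add: Reals_cnj_iff)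
qed

lemma char_poly_real_symmetric_splits:
  fixes A :: "real mat"
  assumes A: "A \<in> carrier_mat n n" and sym: "transpose_mat A = A"
  obtains es where "char_poly A = (\<Prod>e\<leftarrow>es. [:- e, 1:])" "length es = n"
proof -
  let ?A = "map_mat complex_of_real A"
  interpret h: map_poly_inj_idom_hom complex_of_real ..
  have A': "?A \<in> carrier_mat n n" using A by simp
  obtain as where as: "char_poly ?A = (\<Prod>a\<leftarrow>as. [:- a, 1:])" "length as = n"
    using char_poly_factorized[OF A'] by blast
  have "a \<in> \<real>" if "a \<in> set as" for a
  proof -
    have "poly (char_poly ?A) a = 0"
      using that unfolding as by (simp add: poly_prod_list prod_list_zero_iff image_iff)
    then show ?thesis
      using eigenvalue_of_real_symmetric_real[OF A sym] eigenvalue_root_char_poly[OF A'] by blast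
  qed
  then have as_re: "as = map of_real (map Re as)"
    by (simp add: map_idI)
  have "map_poly complex_of_real (char_poly A) = char_poly ?A"
    by (simp add: of_real_hom.char_poly_hom[OF A])
  also have "\<dots> = (\<Prod>a\<leftarrow>map of_real (map Re as). [:- a, 1:])"
    using as as_re by metis
  also have "\<dots> = map_poly complex_of_real (\<Prod>e\<leftarrow>map Re as. [:- e, 1:])"
    by (simp add: h.hom_prod_list o_def)
  finally have "char_poly A = (\<Prod>e\<leftarrow>map Re as. [:- e, 1:])"
    by simp
  then show thesis using that[of "map Re as"] as by simp
qed

text \<open>
  One Gram--Schmidt step on a flag of invariant subspaces: the component \<open>w\<close> of \<open>q\<close> orthogonal to
  \<open>p\<close> satisfies \<open>A w = f w\<close> modulo \<open>p\<close>, so the quadratic form of \<open>A\<close> at the normalised \<open>w\<close> is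
  \<open>f\<close> although \<open>w\<close> need not be an eigenvector.
\<close>

lemma orthonormalize_invariant_flag:
  fixes A :: "'i \<Rightarrow> 'i \<Rightarrow> real" and p q :: "'i \<Rightarrow> real"
  assumes fin: "finite I"
    and Ap: "\<And>i. i \<in> I \<Longrightarrow> (\<Sum>j\<in>I. A i j * p j) = e * p i"
    and Aq: "\<And>i. i \<in> I \<Longrightarrow> (\<Sum>j\<in>I. A i j * q j) = b * p i + f * q i"
    and p0: "\<exists>i\<in>I. p i \<noteq> 0" and indep: "\<And>t. \<exists>i\<in>I. q i \<noteq> t * p i"
  obtains u v where "(\<Sum>i\<in>I. (u i)\<^sup>2) = 1" "(\<Sum>i\<in>I. (v i)\<^sup>2) = 1" "(\<Sum>i\<in>I. u i * v i) = 0"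
    "(\<Sum>i\<in>I. \<Sum>j\<in>I. A i j * (u i * u j)) = e" "(\<Sum>i\<in>I. \<Sum>j\<in>I. A i j * (v i * v j)) = f"
proof -
  define \<alpha> where "\<alpha> = (\<Sum>i\<in>I. (p i)\<^sup>2)"
  define t where "t = (\<Sum>i\<in>I. p i * q i) / \<alpha>"
  define w where "w i = q i - t * p i" for i
  define \<beta> where "\<beta> = (\<Sum>i\<in>I. (w i)\<^sup>2)"
  have \<alpha>0: "\<alpha> > 0"
    unfolding \<alpha>_def using fin p0 by (metis sum_pos2 zero_le_power2 zero_less_power2)
  have "\<exists>i\<in>I. w i \<noteq> 0" using indep[of t] by (auto simp: w_def)
  then have \<beta>0: "\<beta> > 0"
    unfolding \<beta>_def using fin by (metis sum_pos2 zero_le_power2 zero_less_power2)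
  have pw: "(\<Sum>i\<in>I. p i * w i) = 0"
  proof -
    have "(\<Sum>i\<in>I. p i * w i) = (\<Sum>i\<in>I. p i * q i - t * (p i)\<^sup>2)"
      by (intro sum.cong refl) (simp add: w_def power2_eq_square algebra_simps)
    also have "\<dots> = (\<Sum>i\<in>I. p i * q i) - t * \<alpha>"
      by (simp add: sum_subtractf sum_distrib_left[symmetric] \<alpha>_def)
    finally show ?thesis using \<alpha>0 by (simp add: t_def)
  qed
  have Aw: "(\<Sum>j\<in>I. A i j * w j) = (b + f * t - t * e) * p i + f * w i" if "i \<in> I" for i
  proof -
    have "(\<Sum>j\<in>I. A i j * w j) = (\<Sum>j\<in>I. A i j * q j - t * (A i j * p j))"
      by (intro sum.cong refl) (simp add: w_def algebra_simps)
    also have "\<dots> = (b * p i + f * q i) - t * (e * p i)"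
      by (simp add: sum_subtractf sum_distrib_left[symmetric] Ap Aq that)
    finally show ?thesis by (simp add: w_def algebra_simps)
  qed
  define u v where "u i = p i / sqrt \<alpha>" and "v i = w i / sqrt \<beta>" for i
  have quad: "(\<Sum>i\<in>I. \<Sum>j\<in>I. A i j * (g i / s * (g j / s))) = (\<Sum>i\<in>I. g i * (\<Sum>j\<in>I. A i j * g j)) / s\<^sup>2"
    for g s
    unfolding sum_distrib_left sum_divide_distrib
    by (intro sum.cong refl) (simp add: power2_eq_square)
  show thesis
  proof (rule that[of u v])
    show "(\<Sum>i\<in>I. (u i)\<^sup>2) = 1"
      using \<alpha>0 by (simp add: u_def power_divide sum_divide_distrib[symmetric] \<alpha>_def[symmetric])
    show "(\<Sum>i\<in>I. (v i)\<^sup>2) = 1"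
      using \<beta>0 by (simp add: v_def power_divide sum_divide_distrib[symmetric] \<beta>_def[symmetric])
    show "(\<Sum>i\<in>I. u i * v i) = 0"
      using pw by (simp add: u_def v_def sum_divide_distrib[symmetric])
    have "(\<Sum>i\<in>I. p i * (\<Sum>j\<in>I. A i j * p j)) = e * \<alpha>"
      by (simp add: Ap \<alpha>_def sum_distrib_left power2_eq_square mult.left_commute)
    then show "(\<Sum>i\<in>I. \<Sum>j\<in>I. A i j * (u i * u j)) = e"
      using \<alpha>0 unfolding u_def quad by simp
    have "(\<Sum>i\<in>I. w i * (\<Sum>j\<in>I. A i j * w j))
        = (\<Sum>i\<in>I. (b + f * t - t * e) * (p i * w i) + f * (w i)\<^sup>2)"
      by (intro sum.cong refl, subst Aw) (simp_all add: power2_eq_square algebra_simps)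
    also have "\<dots> = f * \<beta>"
      by (simp add: sum.distrib sum_distrib_left[symmetric] pw \<beta>_def)
    finally show "(\<Sum>i\<in>I. \<Sum>j\<in>I. A i j * (v i * v j)) = f"
      using \<beta>0 unfolding v_def quad by simp
  qed
qed

text \<open>
  The first two columns of \<open>P\<close> in a Schur decomposition \<open>A = P B Q\<close> span such a flag. The Schur form may
  list the eigenvalues in any prescribed order, so the first two entries of \<open>es\<close> can be any two
  eigenvalues counted with multiplicity. A repeated eigenvalue needs no separate treatment.
\<close>

lemma orthonormal_pair_with_eigenvalue_forms:
  fixes A :: "real mat"
  assumes A: "A \<in> carrier_mat n n"
    and cp: "char_poly A = (\<Prod>e\<leftarrow>es. [:- e, 1:])" and n: "n \<ge> 2"
  obtains u v :: "nat \<Rightarrow> real" where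
    "(\<Sum>i<n. (u i)\<^sup>2) = 1" "(\<Sum>i<n. (v i)\<^sup>2) = 1" "(\<Sum>i<n. u i * v i) = 0"
    "(\<Sum>i<n. \<Sum>j<n. A $$ (i, j) * (u i * u j)) = es ! 0"
    "(\<Sum>i<n. \<Sum>j<n. A $$ (i, j) * (v i * v j)) = es ! 1"
proof -
  obtain B P Q where "schur_decomposition A es = (B, P, Q)"
    by (cases "schur_decomposition A es")
  from schur_decomposition[OF A cp this]
  have wit: "similar_mat_wit A B P Q" and ut: "upper_triangular B" and diag: "diag_mat B = es"
    by auto
  note w = similar_mat_witD2[OF A wit]
  have "A * P = P * B * Q * P"
    by (rule arg_cong[OF w(3), of "\<lambda>X. X * P"])
  also have "\<dots> = P * B * (Q * P)"
    by (rule assoc_mult_mat[of _ n n _ n _ n]) (use w(5-7) in auto)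
  also have "\<dots> = P * B"
    using w(5,6) by (simp add: w(2))
  finally have AP: "A * P = P * B" .
  have idx: "(X * Y) $$ (i, j) = (\<Sum>k<n. X $$ (i, k) * Y $$ (k, j))"
    if "X \<in> carrier_mat n n" "Y \<in> carrier_mat n n" "i < n" "j < n" for X Y :: "real mat" and i j
    using that by (auto simp: scalar_prod_def atLeast0LessThan intro!: sum.cong)
  have B0: "B $$ (k, l) = 0" if "l < k" "k < n" for k l
    using ut that w unfolding upper_triangular_def by auto
  have Bd: "B $$ (k, k) = es ! k" if "k < n" for k
    using that w unfolding diag[symmetric] by (simp add: diag_mat_def)
  have col0: "(\<Sum>j<n. A $$ (i, j) * P $$ (j, 0)) = es ! 0 * P $$ (i, 0)" if "i < n" for i
  proof -
    have "(\<Sum>j<n. A $$ (i, j) * P $$ (j, 0)) = (\<Sum>k<n. P $$ (i, k) * B $$ (k, 0))"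
      using idx[OF A w(6) that, of 0] idx[OF w(6) w(5) that, of 0] AP n by simp
    also have "\<dots> = (\<Sum>k\<in>{0}. P $$ (i, k) * B $$ (k, 0))"
      using n B0 by (intro sum.mono_neutral_right) auto
    finally show ?thesis using Bd[of 0] n by simp
  qed
  have col1: "(\<Sum>j<n. A $$ (i, j) * P $$ (j, 1)) = B $$ (0, 1) * P $$ (i, 0) + es ! 1 * P $$ (i, 1)"
    if "i < n" for i
  proof -
    have "(\<Sum>j<n. A $$ (i, j) * P $$ (j, 1)) = (\<Sum>k<n. P $$ (i, k) * B $$ (k, 1))"
      using idx[OF A w(6) that, of 1] idx[OF w(6) w(5) that, of 1] AP n by simp
    also have "\<dots> = (\<Sum>k\<in>{0, 1}. P $$ (i, k) * B $$ (k, 1))"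
      using n B0 by (intro sum.mono_neutral_right) auto
    finally show ?thesis using Bd[of 1] n by simp
  qed
  have QP: "(\<Sum>k<n. Q $$ (i, k) * P $$ (k, j)) = (if i = j then 1 else 0)" if "i < n" "j < n" for i j
    using idx[OF w(7) w(6) that] w(2) that by simp
  show thesis
  proof (rule orthonormalize_invariant_flag[of "{..<n}" "\<lambda>i j. A $$ (i, j)" "\<lambda>i. P $$ (i, 0)"
        "es ! 0" "\<lambda>i. P $$ (i, 1)" "B $$ (0, 1)" "es ! 1"])
    show "\<exists>i\<in>{..<n}. P $$ (i, 0) \<noteq> 0"
    proof (rule ccontr)
      assume "\<not> ?thesis"
      then have "(\<Sum>k<n. Q $$ (0, k) * P $$ (k, 0)) = 0" by (intro sum.neutral) auto
      then show False using QP[of 0 0] n by simp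
    qed
    show "\<exists>i\<in>{..<n}. P $$ (i, 1) \<noteq> t * P $$ (i, 0)" for t
    proof (rule ccontr)
      assume "\<not> ?thesis"
      then have "(\<Sum>k<n. Q $$ (1, k) * P $$ (k, 1)) = t * (\<Sum>k<n. Q $$ (1, k) * P $$ (k, 0))"
        unfolding sum_distrib_left by (intro sum.cong) auto
      then show False using QP[of 1 1] QP[of 1 0] n by simp
    qed
  qed (use col0 col1 that in auto)
qed

lemma proots_prod_linear_factors:
  "proots (\<Prod>e\<leftarrow>es. [:- e, 1:]) = mset (es :: 'a :: idom list)"
proof (induction es)
  case (Cons e es)
  have "(\<Prod>e\<leftarrow>es. [:- e, 1:]) \<noteq> 0"
    by (auto simp: prod_list_zero_iff)
  then have "proots ([:- e, 1:] * (\<Prod>e\<leftarrow>es. [:- e, 1:]))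
      = proots [:- e, 1:] + proots (\<Prod>e\<leftarrow>es. [:- e, 1:])"
    by (intro proots_mult) auto
  then show ?case using Cons by simp
qed simp

lemma char_poly_eq_prod_eigenvalues_desc:
  fixes A :: "real mat"
  assumes "A \<in> carrier_mat n n" and "transpose_mat A = A"
  shows "char_poly A = (\<Prod>e\<leftarrow>rev (eigenvalues_desc A). [:- e, 1:])"
    and "length (eigenvalues_desc A) = n"
proof -
  obtain bs where bs: "char_poly A = (\<Prod>e\<leftarrow>bs. [:- e, 1:])" "length bs = n"
    using char_poly_real_symmetric_splits[OF assms] .
  have m: "mset (rev (eigenvalues_desc A)) = mset bs"
    unfolding eigenvalues_desc_def bs(1) proots_prod_linear_factors by simp
  have "(\<Prod>e\<leftarrow>rev (eigenvalues_desc A). [:- e, 1:]) = (\<Prod>e\<leftarrow>bs. [:- e, 1:])"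
    unfolding prod_mset_prod_list[symmetric] mset_map m ..
  then show "char_poly A = (\<Prod>e\<leftarrow>rev (eigenvalues_desc A). [:- e, 1:])"
    by (simp only: bs(1))
  show "length (eigenvalues_desc A) = n"
    using mset_eq_length[OF m] bs(2) by simp
qed

section \<open>Adjacency matrices\<close>

lemma adjacency_matrix_carrier:
  "adjacency_matrix G \<in> carrier_mat (card (pverts G)) (card (pverts G))"
  by (simp add: adjacency_matrix_def Let_def)

lemma adjacency_matrix_symmetric:
  assumes "pair_graph G"
  shows "transpose_mat (adjacency_matrix G) = adjacency_matrix G"
proof -
  interpret pair_graph G by fact
  show ?thesis
    by (rule eq_matI) (auto simp: adjacency_matrix_def Let_def dest: arcs_symmetric)
qed

lemma two_smallest_graph_eigenvalues_ge:
  assumes G: "pair_graph G" and n: "card (pverts G) = n" "n \<ge> 3"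
  shows "graph_eigenvalue G (n - 1) + graph_eigenvalue G n \<ge> - (31/64) * sqrt 2 * n"
proof -
  define A where "A = adjacency_matrix G"
  have A: "A \<in> carrier_mat n n" "transpose_mat A = A"
    using adjacency_matrix_carrier[of G] adjacency_matrix_symmetric[OF G] n by (auto simp: A_def)
  note ev = char_poly_eq_prod_eigenvalues_desc[OF A]
  obtain u v :: "nat \<Rightarrow> real" where uv: "(\<Sum>i<n. (u i)\<^sup>2) = 1" "(\<Sum>i<n. (v i)\<^sup>2) = 1"
      "(\<Sum>i<n. u i * v i) = 0"
    and form: "(\<Sum>i<n. \<Sum>j<n. A $$ (i, j) * (u i * u j)) = rev (eigenvalues_desc A) ! 0"
      "(\<Sum>i<n. \<Sum>j<n. A $$ (i, j) * (v i * v j)) = rev (eigenvalues_desc A) ! 1"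
    using orthonormal_pair_with_eigenvalue_forms[OF A(1) ev(1)] ev(2) n(2) by auto
  have "rev (eigenvalues_desc A) ! 0 = graph_eigenvalue G n"
    "rev (eigenvalues_desc A) ! 1 = graph_eigenvalue G (n - 1)"
    using ev(2) n(2) by (auto simp: rev_nth graph_eigenvalue_def A_def numeral_2_eq_2)
  moreover have "0 \<le> A $$ (i, j) \<and> A $$ (i, j) \<le> 1" if "i < n" "j < n" for i j
    using that n by (simp add: A_def adjacency_matrix_def Let_def)
  ultimately show ?thesis
    using sum_quadratic_forms_orthonormal_ge[of "{..<n}" "\<lambda>i j. A $$ (i, j)", OF _ _ uv] form
    by simp
qed

theorem theorem1p2:
  shows "\<exists>\<epsilon>::real. \<epsilon> > 0 \<and>
    Inf {(graph_eigenvalue G (n - 1) + graph_eigenvalue G n) / real n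
         | (G :: nat pair_pre_digraph) (n :: nat).
           pair_graph G \<and> card (pverts G) = n \<and> n \<ge> 3}
      > - (sqrt 2 / 2) + \<epsilon>"
proof (intro exI[of _ "sqrt 2 / 128"] conjI)
  let ?X = "{(graph_eigenvalue G (n - 1) + graph_eigenvalue G n) / real n
         | (G :: nat pair_pre_digraph) (n :: nat).
           pair_graph G \<and> card (pverts G) = n \<and> n \<ge> 3}"
  \<comment> \<open>The infimum of the empty set is unspecified, so some graph has to be exhibited.\<close>
  define E :: "nat pair_pre_digraph" where "E = \<lparr>pverts = {0, 1, 2}, parcs = {}\<rparr>"
  have "pair_graph E"
    by unfold_locales (auto simp: E_def arcs_ends_def symmetric_def sym_def)
  moreover have "card (pverts E) = 3" by (simp add: E_def)
  ultimately have "?X \<noteq> {}" by blast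
  moreover have "- (31/64) * sqrt 2 \<le> x" if "x \<in> ?X" for x
  proof -
    from that obtain G :: "nat pair_pre_digraph" and n where
      "x = (graph_eigenvalue G (n - 1) + graph_eigenvalue G n) / real n"
      "pair_graph G" "card (pverts G) = n" "n \<ge> 3"
      by blast
    then show ?thesis
      using two_smallest_graph_eigenvalues_ge[of G n] by (simp add: pos_le_divide_eq)
  qed
  ultimately have "- (31/64) * sqrt 2 \<le> Inf ?X"
    by (rule cInf_greatest)
  moreover have "- (sqrt 2 / 2) + sqrt 2 / 128 < - (31/64) * sqrt 2"
    by simp
  ultimately show "- (sqrt 2 / 2) + sqrt 2 / 128 < Inf ?X"
    by linarith
qed simp

end
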